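(* Let $\alpha\in[0,1]$, let $n\ge 1$, and let $S_n=s_1s_2\cdots s_n$ be a random binary string whose letters $s_1,\dots,s_n\in\{0,1\}$ are independent with $\Pr[s_i=1]=\alpha$ (and $\Pr[s_i=0]=1-\alpha$) for all $1\le i\le n$. Then the expected number of distinct subsequences of $S_n$ is $$E[\phi(S_n)]=\begin{cases} n & \text{if } \alpha\in\{0,1\},\\[4pt] \dfrac{\left(1-2\sqrt{\alpha(1-\alpha)}\right)\left(1-\left(1-\sqrt{\alpha(1-\alpha)}\right)^n\right)+\left(1+2\sqrt{\alpha(1-\alpha)}\right)\left(\left(1+\sqrt{\alpha(1-\alpha)}\right)^n-1\right)}{2\sqrt{\alpha(1-\alpha)}} & \text{if } \alpha\in(0,1).\end{cases}$$
   Context: A string $B$ of length $m$ with $1\le m\le n$ is a subsequence of a string $A=a_1a_2\cdots a_n$ if there are indices $i_1<i_2<\dots<i_m$ with $B=a_{i_1}a_{i_2}\cdots a_{i_m}$. For a string $T$, $\phi(T)$ denotes the number of distinct strings that are subsequences of $T$; the empty string is not counted as a subsequence. *)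

theory Defs
  imports "HOL-Probability.Probability" "HOL-Library.Sublist"
begin

text \<open>
  The number of distinct nonempty subsequences of a string. The library relation \<open>subseq\<close>
  is the scattered one (letters need not be contiguous, cf. \<open>subseq_conv_nths\<close>) and holds
  for the empty list, which is therefore excluded explicitly.
\<close>

definition num_subseqs :: "'a list \<Rightarrow> nat" ("\<phi>") where
  "\<phi> T = card {B. B \<noteq> [] \<and> subseq B T}"

end

theory Submission
  imports Defs
begin

text \<open>
  Sort the distinct subsequences of a binary string by their first letter. Prepending a letter
  \<open>a\<close> to \<open>T\<close> does not change the set of subsequences that start with the other letter, while the
  ones that start with \<open>a\<close> become exactly \<open>a # B\<close> for \<open>B\<close> an arbitrary, possibly empty,
  subsequence of \<open>T\<close>. Let \<open>u c T\<close> be one more than the number of distinct subsequences of \<open>T\<close> that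
  start with \<open>c\<close>; this shift absorbs the empty subsequence, and the remark becomes the homogeneous
  rule \<open>u c (a # T) = u c T + (if a = c then u d T else 0)\<close> with \<open>d\<close> the other letter
  (\<open>lead_count_Cons\<close>).

  The letter \<open>a\<close> is independent of \<open>T\<close>, so the expectations \<open>X\<close> and \<open>Y\<close> of \<open>u 1\<close> and \<open>u 0\<close> evolve
  by \<open>X' = X + \<alpha> Y\<close> and \<open>Y' = Y + (1 - \<alpha>) X\<close> from \<open>X = Y = 1\<close> (\<open>expectation_lead_count_Cons\<close>).
  The matrix of this linear recurrence has the eigenvalues \<open>1 + r\<close> and \<open>1 - r\<close> where
  \<open>r = sqrt (\<alpha> * (1 - \<alpha>))\<close>. If \<open>r \<noteq> 0\<close> its solution is a combination of \<open>(1 + r) ^ n\<close> and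
  \<open>(1 - r) ^ n\<close>; if \<open>\<alpha>\<close> is 0 or 1, the matrix is unipotent, and \<open>X + Y = n + 2\<close>. The expected
  number of nonempty subsequences is \<open>X + Y - 2\<close>.
\<close>

section \<open>Subsequences by first letter\<close>

text \<open>
  The set collects what follows the initial letter \<open>c\<close>: deleting \<open>c\<close> is injective, so its size is
  the number of distinct subsequences that start with \<open>c\<close>. The added 1 makes the recursion over the
  string homogeneous; it can be read as counting the empty subsequence once for every letter.
\<close>

definition lead_count :: "'a \<Rightarrow> 'a list \<Rightarrow> nat" where
  "lead_count c T = Suc (card {B. subseq (c # B) T})"

lemma lead_count_Nil [simp]: "lead_count c [] = 1"
  by (simp add: lead_count_def)

lemma finite_subseq: "finite {B. subseq B T}"
  unfolding set_subseqs_eq[symmetric] by simp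

lemma finite_subseq_Cons: "finite {B. subseq (c # B) T}"
  by (rule finite_subset[OF _ finite_subseq[of T]]) (auto dest: subseq_Cons')

lemma card_subseq: "card {B. subseq B T} = Suc (\<phi> T)"
proof -
  have "{B. subseq B T} = insert [] {B. B \<noteq> [] \<and> subseq B T}"
    by auto
  moreover have "finite {B. B \<noteq> [] \<and> subseq B T}"
    by (rule finite_subset[OF _ finite_subseq[of T]]) auto
  ultimately show ?thesis
    by (simp add: num_subseqs_def)
qed

lemma num_subseqs_eq_lead_count:
  assumes "set T \<subseteq> {c, d}" "c \<noteq> d"
  shows "\<phi> T + 2 = lead_count c T + lead_count d T"
proof -
  let ?S = "\<lambda>x. {B. subseq (x # B) T}"
  have "{B. B \<noteq> [] \<and> subseq B T} = (#) c ` ?S c \<union> (#) d ` ?S d"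
  proof (intro equalityI subsetI)
    fix B assume "B \<in> {B. B \<noteq> [] \<and> subseq B T}"
    then have B: "B \<noteq> []" "subseq B T" by auto
    then obtain x B' where "B = x # B'" by (cases B) auto
    moreover from this have "x \<in> {c, d}"
      using B assms(1) by (auto elim: list_emb_set)
    ultimately show "B \<in> (#) c ` ?S c \<union> (#) d ` ?S d"
      using B by auto
  qed auto
  moreover have "card ((#) c ` ?S c \<union> (#) d ` ?S d) = card (?S c) + card (?S d)"
    using assms(2) by (subst card_Un_disjoint) (auto simp: finite_subseq_Cons card_image)
  ultimately show ?thesis
    by (simp add: num_subseqs_def lead_count_def)
qed

text \<open>
  If \<open>a = c\<close>, the words \<open>B\<close> with \<open>c # B\<close> a subsequence of \<open>a # T\<close> are all subsequences of \<open>T\<close>, and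
  these are the ones starting with \<open>c\<close>, the ones starting with \<open>d\<close>, and the empty one.
\<close>

lemma lead_count_Cons:
  assumes "set T \<subseteq> {c, d}" "c \<noteq> d"
  shows "lead_count c (a # T) = lead_count c T + of_bool (a = c) * lead_count d T"
  using card_subseq[of T] num_subseqs_eq_lead_count[OF assms]
  by (simp add: lead_count_def)

lemma lead_count_le: "lead_count c T \<le> Suc (2 ^ length T)"
proof -
  have "card {B. subseq (c # B) T} \<le> card {B. subseq B T}"
    by (intro card_mono finite_subseq) (auto dest: subseq_Cons')
  also have "\<dots> \<le> 2 ^ length T"
    by (metis card_length length_subseqs set_subseqs_eq)
  finally show ?thesis
    by (simp add: lead_count_def)
qed

section \<open>Expectations over a random word\<close>

context prob_space
begin

text \<open>
  A word of fixed length over a countable alphabet lives in a discrete product space, so every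
  function of it is measurable.
\<close>

lemma integrable_random_word:
  fixes s :: "nat \<Rightarrow> 'a \<Rightarrow> 'b :: countable" and g :: "'b list \<Rightarrow> real"
  assumes s: "\<And>i. i \<in> {k..<n} \<Longrightarrow> random_variable (count_space UNIV) (s i)"
    and g: "\<And>T. length T = n - k \<Longrightarrow> \<bar>g T\<bar> \<le> C"
  shows "integrable M (\<lambda>w. g (map (\<lambda>i. s i w) [k..<n]))"
proof (rule integrable_const_bound)
  show "AE w in M. norm (g (map (\<lambda>i. s i w) [k..<n])) \<le> C"
    using g by simp
  have "(\<lambda>w. restrict (\<lambda>i. s i w) {k..<n}) \<in> M \<rightarrow>\<^sub>M PiM {k..<n} (\<lambda>_. count_space UNIV)"
    using s by (intro measurable_restrict)
  moreover have "(\<lambda>x. g (map x [k..<n])) \<in> borel_measurable (PiM {k..<n} (\<lambda>_. count_space UNIV))"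
    by (simp add: count_space_PiM_finite)
  ultimately have "(\<lambda>w. g (map (restrict (\<lambda>i. s i w) {k..<n}) [k..<n])) \<in> borel_measurable M"
    by (rule measurable_compose)
  moreover have "map (restrict (\<lambda>i. s i w) {k..<n}) [k..<n] = map (\<lambda>i. s i w) [k..<n]" for w
    by simp
  ultimately show "(\<lambda>w. g (map (\<lambda>i. s i w) [k..<n])) \<in> borel_measurable M"
    by simp
qed

text \<open>
  The first letter depends only on coordinate \<open>k\<close> of \<open>s\<close> and the rest of the word only on the later
  coordinates, so these two are independent random variables and the expectation factors.
\<close>

lemma
  fixes s :: "nat \<Rightarrow> 'a \<Rightarrow> 'b :: countable" and g :: "'b list \<Rightarrow> real"
  assumes indep: "indep_vars (\<lambda>_. count_space UNIV) s {k..<n}" and "k < n"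
    and g: "\<And>T. length T = n - Suc k \<Longrightarrow> \<bar>g T\<bar> \<le> C"
  shows expectation_letter_times_word:
      "expectation (\<lambda>w. of_bool (s k w = c) * g (map (\<lambda>i. s i w) [Suc k..<n])) =
        \<P>(w in M. s k w = c) * expectation (\<lambda>w. g (map (\<lambda>i. s i w) [Suc k..<n]))"
    and integrable_letter_times_word:
      "integrable M (\<lambda>w. of_bool (s k w = c) * g (map (\<lambda>i. s i w) [Suc k..<n]))"
proof -
  have rv: "random_variable (count_space UNIV) (s i)" if "i \<in> {k..<n}" for i
    using indep that by (auto simp: indep_vars_def2)
  let ?f = "\<lambda>w. of_bool (s k w = c) :: real" and ?g = "\<lambda>w. g (map (\<lambda>i. s i w) [Suc k..<n])"
  have "indep_var borel ((\<lambda>x. of_bool (x k = c) :: real) \<circ> (\<lambda>w. restrict (\<lambda>i. s i w) {k}))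
      borel ((\<lambda>x. g (map x [Suc k..<n])) \<circ> (\<lambda>w. restrict (\<lambda>i. s i w) {Suc k..<n}))"
    using \<open>k < n\<close>
    by (intro indep_var_compose[OF indep_var_restrict[OF indep]])
       (auto simp: count_space_PiM_finite)
  moreover have "map (restrict (\<lambda>i. s i w) {Suc k..<n}) [Suc k..<n] = map (\<lambda>i. s i w) [Suc k..<n]"
    for w
    by simp
  ultimately have iv: "indep_var borel ?f borel ?g"
    by (simp add: o_def)
  have ev: "{w \<in> space M. s k w = c} \<in> events"
    using measurable_sets[OF rv[of k], of "{c}"] \<open>k < n\<close> by (simp add: vimage_def Int_def conj_commute)
  have f_eq: "?f w = indicator {w \<in> space M. s k w = c} w" if "w \<in> space M" for w
    using that by (simp add: indicator_def)
  have f_int: "integrable M ?f"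
    using ev by (subst Bochner_Integration.integrable_cong[OF refl f_eq])
      (auto intro: integrable_real_indicator simp: less_top[symmetric])
  have f_exp: "expectation ?f = \<P>(w in M. s k w = c)"
    using ev by (subst Bochner_Integration.integral_cong[OF refl f_eq]) auto
  have g_int: "integrable M ?g"
    using rv g by (intro integrable_random_word) auto
  show "expectation (\<lambda>w. ?f w * ?g w) = \<P>(w in M. s k w = c) * expectation ?g"
    using indep_var_lebesgue_integral[OF iv f_int g_int] f_exp by simp
  show "integrable M (\<lambda>w. ?f w * ?g w)"
    by (rule indep_var_integrable[OF iv f_int g_int])
qed

lemma expectation_lead_count_Cons:
  fixes s :: "nat \<Rightarrow> 'a \<Rightarrow> 'b :: countable"
  assumes indep: "indep_vars (\<lambda>_. count_space UNIV) s {k..<n}" and "k < n"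
    and letters: "\<And>i w. i \<in> {k..<n} \<Longrightarrow> w \<in> space M \<Longrightarrow> s i w \<in> {c, d}" and "c \<noteq> d"
  shows "expectation (\<lambda>w. real (lead_count c (map (\<lambda>i. s i w) [k..<n]))) =
      expectation (\<lambda>w. real (lead_count c (map (\<lambda>i. s i w) [Suc k..<n]))) +
      \<P>(w in M. s k w = c) * expectation (\<lambda>w. real (lead_count d (map (\<lambda>i. s i w) [Suc k..<n])))"
proof -
  let ?T = "\<lambda>w. map (\<lambda>i. s i w) [Suc k..<n]"
  have bound: "\<bar>real (lead_count x T)\<bar> \<le> real (Suc (2 ^ (n - Suc k)))" if "length T = n - Suc k" for x T
    using lead_count_le[of x T] that by (simp del: of_nat_Suc)
  have step: "real (lead_count c (map (\<lambda>i. s i w) [k..<n])) =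
      real (lead_count c (?T w)) + of_bool (s k w = c) * real (lead_count d (?T w))"
    if "w \<in> space M" for w
  proof -
    have "set (?T w) \<subseteq> {c, d}"
      using letters[OF _ that] by (simp add: image_subset_iff)
    then have "lead_count c (s k w # ?T w) =
        lead_count c (?T w) + of_bool (s k w = c) * lead_count d (?T w)"
      using \<open>c \<noteq> d\<close> by (rule lead_count_Cons)
    then show ?thesis
      using \<open>k < n\<close> by (simp add: upt_conv_Cons)
  qed
  have "integrable M (\<lambda>w. real (lead_count c (?T w)))"
    using indep by (intro integrable_random_word[OF _ bound]) (auto simp: indep_vars_def2)
  moreover note factors = expectation_letter_times_word integrable_letter_times_word
  note factors[where g = "\<lambda>T. real (lead_count d T)", OF indep \<open>k < n\<close> bound]
  ultimately show ?thesis
    by (subst Bochner_Integration.integral_cong[OF refl step]) simp_all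
qed

end

section \<open>The linear recurrence\<close>

text \<open>
  With \<open>r\<^sup>2 = a * b\<close>, the vectors \<open>(a, r)\<close> and \<open>(a, -r)\<close> are eigenvectors of the recurrence for the
  eigenvalues \<open>1 + r\<close> and \<open>1 - r\<close>; decomposing the start vector \<open>(1, 1)\<close> gives the closed form.
\<close>

lemma coupled_recurrence_closed_form:
  fixes X Y :: "nat \<Rightarrow> real"
  assumes "X 0 = 1" "Y 0 = 1"
    and X: "\<And>m. m < n \<Longrightarrow> X (Suc m) = X m + a * Y m"
    and Y: "\<And>m. m < n \<Longrightarrow> Y (Suc m) = Y m + b * X m"
    and r: "r \<noteq> 0" "r * r = a * b" and "m \<le> n"
  shows "X m = ((r + a) * (1 + r) ^ m + (r - a) * (1 - r) ^ m) / (2 * r)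
    \<and> Y m = ((r + b) * (1 + r) ^ m + (r - b) * (1 - r) ^ m) / (2 * r)"
  using \<open>m \<le> n\<close>
proof (induction m)
  case 0
  then show ?case using assms by simp
next
  case (Suc m)
  define P Q where "P = (1 + r) ^ m" and "Q = (1 - r) ^ m"
  have IH: "2 * r * X m = (r + a) * P + (r - a) * Q" "2 * r * Y m = (r + b) * P + (r - b) * Q"
    using Suc r(1) by (simp_all add: P_def Q_def)
  have "2 * r * X (Suc m) = 2 * r * X m + a * (2 * r * Y m)"
    using X[of m] Suc.prems by (simp add: algebra_simps)
  also have "\<dots> = (r + a) * ((1 + r) * P) + (r - a) * ((1 - r) * Q)"
    unfolding IH using r(2) by algebra
  finally have 1: "2 * r * X (Suc m) = (r + a) * (1 + r) ^ Suc m + (r - a) * (1 - r) ^ Suc m"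
    by (simp add: P_def Q_def)
  have "2 * r * Y (Suc m) = 2 * r * Y m + b * (2 * r * X m)"
    using Y[of m] Suc.prems by (simp add: algebra_simps)
  also have "\<dots> = (r + b) * ((1 + r) * P) + (r - b) * ((1 - r) * Q)"
    unfolding IH using r(2) by algebra
  finally have 2: "2 * r * Y (Suc m) = (r + b) * (1 + r) ^ Suc m + (r - b) * (1 - r) ^ Suc m"
    by (simp add: P_def Q_def)
  from 1 2 show ?case
    using r(1) by (simp add: eq_divide_eq mult.commute)
qed

lemma coupled_recurrence_degenerate:
  fixes X Y :: "nat \<Rightarrow> real"
  assumes "X 0 = 1" "Y 0 = 1"
    and X: "\<And>m. m < n \<Longrightarrow> X (Suc m) = X m"
    and Y: "\<And>m. m < n \<Longrightarrow> Y (Suc m) = Y m + X m" and "m \<le> n"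
  shows "X m = 1 \<and> Y m = 1 + real m"
  using \<open>m \<le> n\<close> by (induction m) (use assms in auto)

section \<open>The expected number of subsequences\<close>

theorem theorem2p9:
  fixes M :: "'w measure" and s :: "nat \<Rightarrow> 'w \<Rightarrow> nat" and \<alpha> :: real and n :: nat
  assumes "prob_space M"
    and "\<alpha> \<in> {0..1}"
    and "n \<ge> 1"
    and "prob_space.indep_vars M (\<lambda>_. count_space {0, 1}) s {1..n}"
    and "\<And>i. i \<in> {1..n} \<Longrightarrow> \<P>(w in M. s i w = 1) = \<alpha>"
    and "\<And>i. i \<in> {1..n} \<Longrightarrow> \<P>(w in M. s i w = 0) = 1 - \<alpha>"
  shows "(\<integral>w. real (\<phi> (map (\<lambda>i. s i w) [1..<n+1])) \<partial>M) =
    (if \<alpha> \<in> {0, 1} then real n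
     else ((1 - 2 * sqrt (\<alpha> * (1 - \<alpha>))) * (1 - (1 - sqrt (\<alpha> * (1 - \<alpha>))) ^ n)
           + (1 + 2 * sqrt (\<alpha> * (1 - \<alpha>))) * ((1 + sqrt (\<alpha> * (1 - \<alpha>))) ^ n - 1))
          / (2 * sqrt (\<alpha> * (1 - \<alpha>))))"
proof -
  interpret prob_space M by fact
  have letters: "s i w \<in> {0, 1}" if "i \<in> {1..n}" "w \<in> space M" for i w
    using assms(4) that measurable_space[of "s i" M "count_space {0, 1}" w]
    by (auto simp: indep_vars_def2)
  have indep: "indep_vars (\<lambda>_. count_space UNIV) s {1..<n+1}"
    using indep_vars_compose2[OF assms(4), of "\<lambda>_ x. x" "\<lambda>_. count_space UNIV"]
    by (simp add: atLeastLessThanSuc_atLeastAtMost)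
  \<comment> \<open>The recurrence prepends letters, so it runs over the suffixes of the word: \<open>m\<close> is the length
    of a suffix.\<close>
  define E where
    "E c m = expectation (\<lambda>w. real (lead_count c (map (\<lambda>i. s i w) [n + 1 - m..<n+1])))" for c m
  have E_0: "E c 0 = 1" for c
    by (simp add: E_def prob_space)
  have E_Suc: "E c (Suc m) = E c m + \<P>(w in M. s (n - m) w = c) * E d m"
    if "m < n" and cd: "{c, d} = {0, 1}" "c \<noteq> d" for c d m
  proof -
    have sub: "{n - m..<n+1} \<subseteq> {1..<n+1}"
      using \<open>m < n\<close> by auto
    have "s i w \<in> {c, d}" if "i \<in> {n - m..<n+1}" "w \<in> space M" for i w
      using letters[of i w] subsetD[OF sub that(1)] that(2) unfolding cd(1) by simp
    moreover note indep_vars_subset[OF indep sub]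
    moreover have "n - m < n + 1" by simp
    ultimately have
      "expectation (\<lambda>w. real (lead_count c (map (\<lambda>i. s i w) [n - m..<n+1]))) =
        expectation (\<lambda>w. real (lead_count c (map (\<lambda>i. s i w) [Suc (n - m)..<n+1]))) +
        \<P>(w in M. s (n - m) w = c) *
          expectation (\<lambda>w. real (lead_count d (map (\<lambda>i. s i w) [Suc (n - m)..<n+1])))"
      using cd(2) by (intro expectation_lead_count_Cons)
    moreover have "n + 1 - m = Suc (n - m)" "n + 1 - Suc m = n - m"
      using that by auto
    ultimately show ?thesis
      by (simp only: E_def)
  qed
  have E1: "E 1 (Suc m) = E 1 m + \<alpha> * E 0 m" if "m < n" for m
    using E_Suc[of m 1 0] assms(5)[of "n - m"] that by auto
  have E0: "E 0 (Suc m) = E 0 m + (1 - \<alpha>) * E 1 m" if "m < n" for m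
    using E_Suc[of m 0 1] assms(6)[of "n - m"] that by auto

  let ?T = "\<lambda>w. map (\<lambda>i. s i w) [1..<n+1]"
  have int: "integrable M (\<lambda>w. real (lead_count c (?T w)))" for c
  proof (rule integrable_random_word[where C = "real (Suc (2 ^ n))"])
    show "\<bar>real (lead_count c T)\<bar> \<le> real (Suc (2 ^ n))" if "length T = n + 1 - 1" for T
      using lead_count_le[of c T] that by (simp del: of_nat_Suc)
  qed (use indep in \<open>auto simp: indep_vars_def2\<close>)
  have "real (\<phi> (?T w)) = real (lead_count 1 (?T w)) + real (lead_count 0 (?T w)) - 2"
    if "w \<in> space M" for w
  proof -
    have "\<forall>i \<in> {1..n}. s i w \<in> {1, 0}"
      using letters[OF _ that] by blast
    then have "set (?T w) \<subseteq> {1, 0}"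
      by (auto simp: image_subset_iff less_Suc_eq_le simp del: upt_Suc)
    then have "\<phi> (?T w) + 2 = lead_count 1 (?T w) + lead_count 0 (?T w)"
      by (rule num_subseqs_eq_lead_count) simp
    then show ?thesis by linarith
  qed
  then have "expectation (\<lambda>w. real (\<phi> (?T w))) =
      expectation (\<lambda>w. real (lead_count 1 (?T w)) + real (lead_count 0 (?T w)) - 2)"
    by (intro Bochner_Integration.integral_cong) auto
  also have "\<dots> = E 1 n + E 0 n - 2"
    using int[of 1] int[of 0] by (simp add: E_def prob_space del: upt_Suc)
  finally have main: "expectation (\<lambda>w. real (\<phi> (?T w))) = E 1 n + E 0 n - 2" .

  consider "\<alpha> = 0" | "\<alpha> = 1" | "0 < \<alpha>" "\<alpha> < 1"
    using assms(2) by fastforce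
  then show ?thesis
  proof cases
    case 1
    then show ?thesis
      using coupled_recurrence_degenerate[of "E 1" "E 0" n n] E_0 E1 E0 main by simp
  next
    case 2
    then show ?thesis
      using coupled_recurrence_degenerate[of "E 0" "E 1" n n] E_0 E1 E0 main by simp
  next
    case 3
    define r where "r = sqrt (\<alpha> * (1 - \<alpha>))"
    have r: "r \<noteq> 0" "r * r = \<alpha> * (1 - \<alpha>)"
      using 3 by (simp_all add: r_def)
    define P Q where "P = (1 + r) ^ n" and "Q = (1 - r) ^ n"
    have "E 1 n = ((r + \<alpha>) * P + (r - \<alpha>) * Q) / (2 * r)"
      "E 0 n = ((r + (1 - \<alpha>)) * P + (r - (1 - \<alpha>)) * Q) / (2 * r)"
      using coupled_recurrence_closed_form[of "E 1" "E 0" n \<alpha> "1 - \<alpha>" r n] E_0 E1 E0 r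
      by (simp_all add: P_def Q_def)
    then have "E 1 n + E 0 n - 2 = ((1 - 2 * r) * (1 - Q) + (1 + 2 * r) * (P - 1)) / (2 * r)"
      using r(1) by (simp add: field_simps)
    then show ?thesis
      using 3 main by (simp add: P_def Q_def r_def)
  qed
qed

end
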